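(* For every positive integer $r$, \[ \sum_{n=1}^\infty \frac{1}{n(2n+2r-1)}\frac{\binom{4n-2}{2n-1}}{\binom{2n+2r-2}{n+r-1}}\frac{1}{2^{2n}}=\frac{1}{(2r-1)\binom{2r-2}{r-1}}-\frac{1}{2^{2r-2}}\int_0^{\pi/2}\sin^{2r-1}x\,\cos(x/2)\,dx. \] *)

theory Defs
  imports "HOL-Analysis.Analysis"
begin

end

theory Submission
  imports Defs
begin

text \<open>
  By Wallis' formula, the \<open>n\<close>-th term of the series is \<open>4\<^sup>1\<^sup>-\<^sup>r a\<^sub>n \<integral> sin\<^sup>2\<^sup>n\<^sup>+\<^sup>2\<^sup>r\<^sup>-\<^sup>1 x dx\<close> over
  \<open>[0, \<pi>/2]\<close>, where \<open>a\<^sub>n\<close> is minus the coefficient of \<open>s\<^sup>2\<^sup>n\<close> in the binomial series of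
  \<open>sqrt (1 + s)\<close>. For \<open>s = sin x\<close> the even part \<open>(sqrt (1 + s) + sqrt (1 - s)) / 2\<close> of that
  series equals \<open>cos (x/2)\<close>, so that \<open>\<Sum>\<^sub>n a\<^sub>n sin\<^sup>2\<^sup>n x = 1 - cos (x/2)\<close> with nonnegative terms,
  and dominated convergence lets us integrate this termwise against \<open>sin\<^sup>2\<^sup>r\<^sup>-\<^sup>1 x\<close>.
\<close>

text \<open>The ratio of consecutive central binomial coefficients. It drives two inductions: the
  closed form of \<open>(1/2) gchoose Suc k\<close> and the Wallis integral.\<close>

lemma central_binomial_Suc:
  "(real k + 1) * real ((2 * Suc k) choose Suc k) = 2 * (2 * real k + 1) * real ((2 * k) choose k)"
proof -
  have 1: "Suc k * ((2 * Suc k) choose Suc k) = Suc (2 * k + 1) * ((2 * k + 1) choose k)"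
    using Suc_times_binomial[of k "2 * k + 1"] by simp
  have "Suc k * (Suc (2 * k) choose k) = Suc (2 * k) * ((2 * k) choose k)"
    using Suc_times_binomial_add[of k k] Suc_times_binomial[of k "2 * k"] by (simp add: mult_2)
  hence 2: "(real k + 1) * real ((2 * k + 1) choose k) = (2 * real k + 1) * real ((2 * k) choose k)"
    by (metis (no_types, opaque_lifting) Suc_eq_plus1 of_nat_1 of_nat_add of_nat_mult of_nat_numeral)
  have "real (Suc k) * real ((2 * Suc k) choose Suc k)
      = real (Suc (2 * k + 1)) * real ((2 * k + 1) choose k)"
    using 1 by (metis of_nat_mult)
  hence "(real k + 1) * real ((2 * Suc k) choose Suc k)
      = 2 * ((real k + 1) * real ((2 * k + 1) choose k))"
    by (simp del: mult_Suc_right binomial_Suc_Suc add: algebra_simps)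
  thus ?thesis
    unfolding 2 by (simp only: mult.assoc)
qed

text \<open>Induction on \<open>k\<close>: passing to the next coefficient multiplies by
  \<open>(1/2 - (k + 1)) / (k + 2)\<close>, which matches the ratio of central binomial
  coefficients. Indexing by \<open>Suc k\<close> leaves out the constant coefficient 1, which breaks
  the sign pattern.\<close>

lemma half_gchoose_Suc:
  "((1 / 2 :: real) gchoose Suc k)
     = (-1) ^ k * real ((2 * k) choose k) / ((real k + 1) * 2 ^ (2 * k + 1))"
proof (induction k)
  case 0
  show ?case by simp
next
  case (Suc k)
  define c where "c = real ((2 * k) choose k)"
  define d where "d = real ((2 * Suc k) choose Suc k)"
  have d: "d = 2 * (2 * real k + 1) * c / (real k + 1)"
    using central_binomial_Suc[of k] by (simp add: c_def d_def field_simps del: mult_Suc_right binomial_Suc_Suc)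
  have "(real k + 2) * ((1 / 2 :: real) gchoose Suc (Suc k))
      = (1 / 2 - (real k + 1)) * ((1 / 2) gchoose Suc k)"
    using gbinomial_mult_1[of "1 / 2 :: real" "Suc k"] by (simp add: algebra_simps)
  hence "((1 / 2 :: real) gchoose Suc (Suc k))
      = (1 / 2 - (real k + 1)) * ((1 / 2) gchoose Suc k) / (real k + 2)"
    by (simp add: field_simps)
  also have "\<dots> = (-1) ^ Suc k * d / ((real k + 2) * 2 ^ (2 * k + 3))"
    unfolding Suc.IH d c_def[symmetric] by (simp add: divide_simps power_add) (simp add: algebra_simps)
  finally show ?case
    by (simp add: d_def eval_nat_numeral ac_simps)
qed

text \<open>Averaging the series at \<open>s\<close> and at \<open>- s\<close> cancels the odd
  terms.\<close>

lemma sums_even_part: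
  fixes f :: "nat \<Rightarrow> real"
  assumes "(\<lambda>n. f n * s ^ n) sums A" "(\<lambda>n. f n * (- s) ^ n) sums B"
  shows "(\<lambda>n. f (2 * n) * s ^ (2 * n)) sums ((A + B) / 2)"
proof -
  have "(\<lambda>n. (f n * s ^ n + f n * (- s) ^ n) / 2) sums ((A + B) / 2)"
    by (intro sums_divide sums_add assms)
  \<comment> \<open>Blocks of two consecutive indices each hold one even term and one vanishing odd
    term, so grouping reindexes the series by the even exponents.\<close>
  from sums_group[OF this, of 2]
  have "(\<lambda>n. \<Sum>i = n * 2..<n * 2 + 2. (f i * s ^ i + f i * (- s) ^ i) / 2) sums ((A + B) / 2)"
    by simp
  moreover have "{n * 2..<n * 2 + 2} = {2 * n, Suc (2 * n)}" for n :: nat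
    by auto
  ultimately show ?thesis
    by (simp add: mult.commute[of _ 2])
qed

text \<open>With \<open>y = x / 2\<close>, the radicands are the squares of
  \<open>cos y + sin y\<close> and \<open>cos y - sin y\<close>. Both bases are nonnegative for
  \<open>y\<close> between 0 and \<open>pi / 4\<close>, so the roots add up to
  \<open>2 * cos y\<close>.\<close>

lemma cos_half_eq_sqrt_sin:
  assumes "0 \<le> x" "x \<le> pi / 2"
  shows "(sqrt (1 + sin x) + sqrt (1 - sin x)) / 2 = cos (x / 2)"
proof -
  define y where "y = x / 2"
  have x: "x = 2 * y" and y: "0 \<le> y" "y \<le> pi / 4"
    using assms by (auto simp: y_def)
  have pyth: "(sin y)\<^sup>2 + (cos y)\<^sup>2 = 1"
    by simp
  have "sin y \<le> sin (pi / 4)"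
    by (rule sin_monotone_2pi_le) (use y in auto)
  moreover have "cos (pi / 4) \<le> cos y"
    by (rule cos_monotone_0_pi_le) (use y in auto)
  ultimately have le: "sin y \<le> cos y"
    by (simp add: sin_45 cos_45)
  have "0 \<le> sin y"
    by (rule sin_ge_zero) (use y pi_gt_zero in linarith)+
  have "1 + sin x = (cos y + sin y)\<^sup>2" "1 - sin x = (cos y - sin y)\<^sup>2"
    unfolding x sin_double using pyth by (simp_all add: power2_eq_square algebra_simps)
  thus ?thesis
    using le \<open>0 \<le> sin y\<close> by (simp add: y_def)
qed

text \<open>The coefficient a_n of the overview with \<open>n = k + 1\<close>, so that sums start at
  \<open>k = 0\<close>.\<close>

definition cos_half_coeff :: "nat \<Rightarrow> real" where
  "cos_half_coeff k = real ((4 * k + 2) choose (2 * k + 1)) / ((real k + 1) * 16 ^ (k + 1))"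

lemma half_gchoose_even: "((1 / 2 :: real) gchoose (2 * Suc k)) = - cos_half_coeff k"
proof -
  have "(2 :: real) ^ (4 * k) = 16 ^ k"
    by (simp add: power_mult)
  moreover have "2 * (2 * k + 1) = 4 * k + 2"
    by simp
  ultimately show ?thesis
    using half_gchoose_Suc[of "2 * k + 1"]
    by (simp add: cos_half_coeff_def power_add field_simps del: binomial_Suc_Suc)
qed

text \<open>The endpoint \<open>pi / 2\<close> is excluded because the binomial series is applied
  only where the absolute value of \<open>sin x\<close> is below 1.\<close>

lemma one_minus_cos_half_sums:
  assumes "0 \<le> x" "x < pi / 2"
  shows "(\<lambda>k. cos_half_coeff k * sin x ^ (2 * k + 2)) sums (1 - cos (x / 2))"
proof -
  have "sin x < 1"
    using sin_monotone_2pi[of x "pi / 2"] assms by simp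
  moreover have "0 \<le> sin x"
    using assms by (auto intro: sin_ge_zero)
  ultimately have "\<bar>sin x\<bar> < 1"
    by simp
  hence "(\<lambda>n. ((1/2) gchoose n) * sin x ^ n) sums sqrt (1 + sin x)"
    "(\<lambda>n. ((1/2) gchoose n) * (- sin x) ^ n) sums sqrt (1 - sin x)"
    using sqrt_series[of "sin x"] sqrt_series[of "- sin x"] by simp_all
  from sums_even_part[OF this]
  have "(\<lambda>n. ((1/2) gchoose (2 * n)) * sin x ^ (2 * n)) sums cos (x / 2)"
    using cos_half_eq_sqrt_sin[of x] assms by simp
  \<comment> \<open>The constant term 1 is split off here; negating the rest makes all coefficients
    nonnegative.\<close>
  hence "(\<lambda>n. ((1/2) gchoose (2 * Suc n)) * sin x ^ (2 * Suc n)) sums (cos (x / 2) - 1)"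
    using sums_Suc_iff[of "\<lambda>n. ((1/2) gchoose (2 * n)) * sin x ^ (2 * n)" "cos (x / 2) - 1"]
    by simp
  from sums_minus[OF this] show ?thesis
    unfolding half_gchoose_even by simp
qed

text \<open>Wallis' formula. The function \<open>sin x ^ (2 * m + 2) * cos x\<close> vanishes at
  both endpoints, so its derivative integrates to 0; replacing the squared cosine in that derivative
  relates the integrals for \<open>m\<close> and \<open>Suc m\<close>.\<close>

lemma has_integral_sin_odd_power:
  "((\<lambda>x. sin x ^ (2 * m + 1)) has_integral
      4 ^ m / ((2 * real m + 1) * real ((2 * m) choose m))) {0..pi / 2}"
proof (induction m)
  case 0
  have "((\<lambda>x. sin x) has_integral (- cos (pi / 2) - (- cos 0))) {0..pi / 2}"
    by (rule fundamental_theorem_of_calculus)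
      (auto intro!: derivative_eq_intros simp flip: has_real_derivative_iff_has_vector_derivative)
  thus ?case by simp
next
  case (Suc m)
  let ?n = "2 * m + 1"
  define c where "c = real ((2 * m) choose m)"
  define d where "d = real ((2 * Suc m) choose Suc m)"
  have d: "d = 2 * (2 * real m + 1) * c / (real m + 1)"
    using central_binomial_Suc[of m] by (simp add: c_def d_def field_simps del: mult_Suc_right binomial_Suc_Suc)
  have "c > 0"
    by (simp add: c_def)
  have cos_sq: "cos x * cos x = 1 - sin x * sin x" for x :: real
    using sin_cos_squared_add[of x] by (simp add: power2_eq_square)
  have "((\<lambda>x. (2 * real m + 2) * sin x ^ ?n - (2 * real m + 3) * sin x ^ (2 * Suc m + 1))
      has_integral (sin (pi / 2) ^ (2 * m + 2) * cos (pi / 2) - sin 0 ^ (2 * m + 2) * cos 0))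
      {0..pi / 2}"
  proof (rule fundamental_theorem_of_calculus)
    fix x :: real
    have "((\<lambda>x. sin x ^ (2 * m + 2) * cos x) has_real_derivative
        (2 * real m + 2) * sin x ^ ?n * (cos x * cos x) - sin x ^ (2 * m + 2) * sin x)
        (at x within {0..pi / 2})"
      by (rule derivative_eq_intros refl)+ (simp add: algebra_simps)
    also have "(2 * real m + 2) * sin x ^ ?n * (cos x * cos x) - sin x ^ (2 * m + 2) * sin x
        = (2 * real m + 2) * sin x ^ ?n - (2 * real m + 3) * sin x ^ (2 * Suc m + 1)"
      unfolding cos_sq by (simp add: algebra_simps)
    finally show "((\<lambda>x. sin x ^ (2 * m + 2) * cos x) has_vector_derivative
        (2 * real m + 2) * sin x ^ ?n - (2 * real m + 3) * sin x ^ (2 * Suc m + 1))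
        (at x within {0..pi / 2})"
      by (simp add: has_real_derivative_iff_has_vector_derivative)
  qed simp
  from has_integral_diff[OF has_integral_mult_right[OF Suc.IH, of "2 * real m + 2"] this]
  have "((\<lambda>x. (2 * real m + 3) * sin x ^ (2 * Suc m + 1)) has_integral
      (2 * real m + 2) * (4 ^ m / ((2 * real m + 1) * c))) {0..pi / 2}"
    by (simp add: c_def)
  from has_integral_mult_right[OF this, of "1 / (2 * real m + 3)"]
  have "((\<lambda>x. sin x ^ (2 * Suc m + 1)) has_integral
      (2 * real m + 2) * (4 ^ m / ((2 * real m + 1) * c)) / (2 * real m + 3)) {0..pi / 2}"
    by (simp add: add_pos_nonneg mult_ac del: power_Suc)
  moreover have "(2 * real m + 2) * (4 ^ m / ((2 * real m + 1) * c)) / (2 * real m + 3)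
      = 4 ^ Suc m / ((2 * real (Suc m) + 1) * d)"
    unfolding d using \<open>c > 0\<close> by (simp add: divide_simps) (simp add: algebra_simps)
  ultimately show ?case
    by (simp only: d_def)
qed

lemma termwise_integral_sums:
  "(\<lambda>k. cos_half_coeff k * integral {0..pi / 2} (\<lambda>x. sin x ^ (2 * (m + Suc k) + 1)))
     sums integral {0..pi / 2} (\<lambda>x. sin x ^ (2 * m + 1) * (1 - cos (x / 2)))"
proof -
  let ?t = "\<lambda>k x. cos_half_coeff k * sin x ^ (2 * (m + Suc k) + 1) :: real"
  let ?g = "\<lambda>x :: real. sin x ^ (2 * m + 1) * (1 - cos (x / 2))"
  \<comment> \<open>The open interval avoids the endpoint \<open>pi / 2\<close>, where the pointwise
    expansion has not been established; the integrals are the same as over the closed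
    interval.\<close>
  have term_integrable: "?t k integrable_on {0<..<pi / 2}" for k
    unfolding integrable_on_open_interval_real
    by (intro integrable_continuous_real continuous_intros)
  have g_integrable: "?g integrable_on {0<..<pi / 2}"
    unfolding integrable_on_open_interval_real
    by (intro integrable_continuous_real continuous_intros) auto
  have pointwise: "(\<lambda>k. ?t k x) sums ?g x" and nonneg: "\<And>k. 0 \<le> ?t k x"
    if x: "x \<in> {0<..<pi / 2}" for x
  proof -
    show "(\<lambda>k. ?t k x) sums ?g x"
      using sums_mult[OF one_minus_cos_half_sums[of x], of "sin x ^ (2 * m + 1)"] x
      by (simp add: power_add mult_ac)
    show "0 \<le> ?t k x" for k
      using x sin_ge_zero[of x] by (simp add: cos_half_coeff_def)
  qed
  have "(\<lambda>N. integral {0<..<pi / 2} (\<lambda>x. \<Sum>k<N. ?t k x)) \<longlonglongrightarrow> integral {0<..<pi / 2} ?g"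
  \<comment> \<open>The limit itself dominates: partial sums of nonnegative terms lie between 0 and
    \<open>?g x\<close>.\<close>
  proof (rule dominated_convergence(2)[where h = ?g])
    show "norm (\<Sum>k<N. ?t k x) \<le> ?g x" if "x \<in> {0<..<pi / 2}" for N x
    proof -
      have "(\<Sum>k<N. ?t k x) \<le> ?g x"
        using pointwise[OF that] nonneg[OF that]
        by (metis (no_types, lifting) finite_lessThan sum_le_suminf sums_iff)
      moreover have "0 \<le> (\<Sum>k<N. ?t k x)"
        by (intro sum_nonneg nonneg that)
      ultimately show ?thesis by simp
    qed
    show "(\<lambda>N. \<Sum>k<N. ?t k x) \<longlonglongrightarrow> ?g x" if "x \<in> {0<..<pi / 2}" for x
      using pointwise[OF that] by (simp add: sums_def)
  qed (intro integrable_sum term_integrable g_integrable finite_lessThan)+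
  moreover have "integral {0<..<pi / 2} (\<lambda>x. \<Sum>k<N. ?t k x)
      = (\<Sum>k<N. cos_half_coeff k * integral {0..pi / 2} (\<lambda>x. sin x ^ (2 * (m + Suc k) + 1)))" for N
    by (subst integral_sum) (use term_integrable in \<open>simp_all add: integral_open_interval_real\<close>)
  ultimately show ?thesis
    by (simp add: sums_def integral_open_interval_real)
qed

theorem theorem11:
  fixes r :: nat
  assumes "r \<ge> 1"
  shows "(\<lambda>k. let n = Suc k in
            1 / (real n * (2 * real n + 2 * real r - 1))
            * (real ((4 * n - 2) choose (2 * n - 1)) / real ((2 * n + 2 * r - 2) choose (n + r - 1)))
            * (1 / 2 ^ (2 * n)))
         sums
         (1 / ((2 * real r - 1) * real ((2 * r - 2) choose (r - 1)))
          - 1 / 2 ^ (2 * r - 2)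
            * integral {0..pi / 2} (\<lambda>x. sin x ^ (2 * r - 1) * cos (x / 2)))"
proof -
  \<comment> \<open>With \<open>m = r - 1\<close>, the exponent \<open>2 * r - 1\<close> becomes
    \<open>2 * m + 1\<close> and \<open>2 ^ (2 * r - 2)\<close> becomes
    \<open>4 ^ m\<close>.\<close>
  obtain m where r: "r = Suc m"
    using assms by (cases r) auto
  let ?W = "\<lambda>j. integral {0..pi / 2} (\<lambda>x. sin x ^ (2 * j + 1))"
  let ?I = "integral {0..pi / 2} (\<lambda>x. sin x ^ (2 * m + 1) * cos (x / 2))"
  have W: "?W j = 4 ^ j / ((2 * real j + 1) * real ((2 * j) choose j))" for j
    by (rule integral_unique[OF has_integral_sin_odd_power])
  have "integral {0..pi / 2} (\<lambda>x. sin x ^ (2 * m + 1) * (1 - cos (x / 2))) = ?W m - ?I"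
    unfolding right_diff_distrib mult_1_right
    by (intro Henstock_Kurzweil_Integration.integral_diff integrable_continuous_real
        continuous_intros) auto
  hence "(\<lambda>k. 1 / 4 ^ m * (cos_half_coeff k * ?W (m + Suc k))) sums (1 / 4 ^ m * (?W m - ?I))"
    using sums_mult[OF termwise_integral_sums[of m], of "1 / 4 ^ m"] by (simp only:)
  moreover have "1 / 4 ^ m * (?W m - ?I)
      = 1 / ((2 * real r - 1) * real ((2 * r - 2) choose (r - 1))) - 1 / 2 ^ (2 * r - 2)
          * integral {0..pi / 2} (\<lambda>x. sin x ^ (2 * r - 1) * cos (x / 2))"
    unfolding W by (simp add: r power_mult right_diff_distrib)
  moreover have "1 / 4 ^ m * (cos_half_coeff k * ?W (m + Suc k))
      = (let n = Suc k in 1 / (real n * (2 * real n + 2 * real r - 1))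
            * (real ((4 * n - 2) choose (2 * n - 1)) / real ((2 * n + 2 * r - 2) choose (n + r - 1)))
            * (1 / 2 ^ (2 * n)))" for k
  proof -
    define a where "a = real ((4 * k + 2) choose (2 * k + 1))"
    define b where "b = real ((2 * (m + Suc k)) choose (m + Suc k))"
    \<comment> \<open>Applied with \<open>P = 4 ^ (k + 1)\<close> and \<open>Q = 4 ^ m\<close>:
      \<open>P * P\<close> is the power of 16 in \<open>cos_half_coeff\<close>, and
      \<open>Q * P\<close> is the numerator of the Wallis integral.\<close>
    have cancel: "1 / Q * (a / (K * (P * P)) * (Q * P / (D * b))) = 1 / (K * D) * (a / b) * (1 / P)"
      if "P \<noteq> 0" "Q \<noteq> 0" for P Q D K :: real
      using that by (simp add: divide_simps)
    have "4 * Suc k - 2 = 4 * k + 2" "2 * Suc k - 1 = 2 * k + 1"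
      "2 * Suc k + 2 * r - 2 = 2 * (m + Suc k)" "Suc k + r - 1 = m + Suc k"
      by (simp_all add: r)
    moreover have "(16 :: real) ^ (k + 1) = 4 ^ (k + 1) * 4 ^ (k + 1)"
      "(2 :: real) ^ (2 * Suc k) = 4 ^ (k + 1)" "(4 :: real) ^ (m + Suc k) = 4 ^ m * 4 ^ (k + 1)"
      by (simp_all add: power_mult power_add flip: power_mult_distrib)
    moreover have "2 * real (Suc k) + 2 * real r - 1 = 2 * real (m + Suc k) + 1"
      "real k + 1 = real (Suc k)"
      by (simp_all add: r)
    ultimately show ?thesis
      unfolding Let_def cos_half_coeff_def W
      by (simp only: a_def[symmetric] b_def[symmetric]) (rule cancel, simp_all)
  qed
  ultimately show ?thesis
    by simp
qed

end
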